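(* For $n\geq 0$ let $$f_n(x)=\begin{cases}(1+x^2)(x^2-1)^{2k-2}, & n=2k-1,\\ -(x^2-1)^{2k}, & n=2k.\end{cases}$$ Then for every $n\geq 0$, $F_{n+1}(x)$ equals the lower Hessenberg determinant of order $n+1$ $$F_{n+1}(x)=\det(m_{i,j})_{0\leq i,j\leq n},$$ where $m_{0,0}=x$, $m_{i,0}=x\,F_i(x)$ for $1\leq i\leq n$, $m_{i,j}=\binom{i}{j-1}f_{i-j+1}(x)$ for $1\leq j\leq i\leq n$, $m_{i,i+1}=-1$ for $0\leq i\leq n-1$, and $m_{i,j}=0$ for $j>i+1$.
   Context: The alternating run polynomials of dual Stirling permutations $F_n(x)$ are defined by $\left(x\frac{d}{dx}\right)^n r(x)=\frac{r(x)F_n(x)}{(1-x^2)^n}$ with $r(x)=\sqrt{\frac{1+x}{1-x}}$; equivalently $F_0(x)=1$ and $F_{n+1}(x)=(x+2nx^2)F_n(x)+x(1-x^2)F_n'(x)$. E.g. $F_1=x$, $F_2=x+x^2+x^3$, $F_3=x+3x^2+7x^3+3x^4+x^5$. *)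

theory Defs
  imports "HOL-Analysis.Derivative" "Jordan_Normal_Form.Determinant"
begin

definition r_fun :: "real \<Rightarrow> real" where
  "r_fun x = sqrt ((1 + x) / (1 - x))"

definition xD :: "(real \<Rightarrow> real) \<Rightarrow> real \<Rightarrow> real" where
  "xD g = (\<lambda>x. x * deriv g x)"

text \<open>The identity is imposed on \<open>-1 < x < 1\<close>, where \<open>r_fun\<close> is real-valued and
  differentiable. Existence and uniqueness of the polynomial are proved in \<open>F_rep_ex1\<close>.\<close>

definition F_rep :: "nat \<Rightarrow> real poly \<Rightarrow> bool" where
  "F_rep n p \<longleftrightarrow>
    (\<forall>x\<in>{-1<..<1}. (xD ^^ n) r_fun x = r_fun x * poly p x / (1 - x\<^sup>2) ^ n)"

definition F_poly :: "nat \<Rightarrow> real poly" where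
  "F_poly n = (THE p. F_rep n p)"

lemma r_fun_deriv:
  assumes "x \<in> {-1<..<1}"
  shows "(r_fun has_real_derivative r_fun x / (1 - x\<^sup>2)) (at x)"
proof -
  have x: "-1 < x" "x < 1" using assms by auto
  define q where "q = sqrt ((1 + x) / (1 - x))"
  have q2: "q * q = (1 + x) / (1 - x)" using x by (simp add: q_def)
  have q0: "q > 0" using x by (simp add: q_def)
  have d: "(r_fun has_real_derivative (2 / (1 - x)\<^sup>2) * (inverse q / 2)) (at x)"
    unfolding r_fun_def[abs_def] q_def
    using x by (auto intro!: derivative_eq_intros simp: field_simps power2_eq_square)
  have "inverse q = q / (q * q)" using q0 by (simp add: field_simps)
  also have "\<dots> = q * (1 - x) / (1 + x)" using x by (simp add: q2)
  finally have "(2 / (1 - x)\<^sup>2) * (inverse q / 2) = q / ((1 + x) * (1 - x))"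
    using x by (simp add: power2_eq_square divide_simps)
  also have "\<dots> = r_fun x / (1 - x\<^sup>2)"
    by (simp add: r_fun_def q_def power2_eq_square algebra_simps)
  finally show ?thesis using d by simp
qed

lemma F_rep_0: "F_rep 0 1"
  by (simp add: F_rep_def)

lemma F_rep_Suc:
  assumes "F_rep n p"
  shows "F_rep (Suc n)
    ([:0, 1, 2 * of_nat n:] * p + [:0, 1, 0, -1:] * pderiv p)"
  unfolding F_rep_def
proof
  fix x :: real assume x: "x \<in> {-1<..<1}"
  define u where "u = 1 - x\<^sup>2"
  have "x\<^sup>2 < 1" using x by (simp add: abs_square_less_1 abs_less_iff)
  then have u: "u \<noteq> 0" by (simp add: u_def)
  define P P' R where "P = poly p x" and "P' = poly (pderiv p) x" and "R = r_fun x"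
  have dr: "(r_fun has_real_derivative R / u) (at x)"
    using r_fun_deriv[OF x] by (simp add: R_def u_def)
  have dp: "(poly p has_real_derivative P') (at x)"
    unfolding P'_def by (rule poly_DERIV)
  have dn: "((\<lambda>x. (1 - x\<^sup>2) ^ n) has_real_derivative - (2 * x * (real n * u ^ (n - 1)))) (at x)"
    unfolding u_def by (auto intro!: derivative_eq_intros)
  have "((\<lambda>x. r_fun x * poly p x / (1 - x\<^sup>2) ^ n) has_real_derivative
      ((R / u * P + P' * R) * u ^ n - (R * P) * - (2 * x * (real n * u ^ (n - 1))))
        / (u ^ n * u ^ n)) (at x)"
    using DERIV_divide[OF DERIV_mult[OF dr dp] dn] u
    by (simp add: u_def P_def R_def)
  then have "((xD ^^ n) r_fun has_real_derivative
      ((R / u * P + P' * R) * u ^ n - (R * P) * - (2 * x * (real n * u ^ (n - 1))))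
        / (u ^ n * u ^ n)) (at x)"
    by (rule has_field_derivative_transform_within_open[where S = "{-1<..<1}"])
      (use x assms in \<open>auto simp: F_rep_def\<close>)
  then have "(xD ^^ Suc n) r_fun x = x *
      (((R / u * P + P' * R) * u ^ n - (R * P) * - (2 * x * (real n * u ^ (n - 1))))
        / (u ^ n * u ^ n))"
    by (simp add: xD_def DERIV_imp_deriv)
  also have "\<dots> = R * ((x + 2 * real n * x\<^sup>2) * P + x * u * P') / u ^ Suc n"
    using u by (cases n) (simp_all add: field_simps power2_eq_square)
  also have "(x + 2 * real n * x\<^sup>2) * P + x * u * P' =
      poly ([:0, 1, 2 * of_nat n:] * p + [:0, 1, 0, -1:] * pderiv p) x"
    by (simp add: P_def P'_def u_def algebra_simps power2_eq_square)
  finally show "(xD ^^ Suc n) r_fun x = r_fun x *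
      poly ([:0, 1, 2 * of_nat n:] * p + [:0, 1, 0, -1:] * pderiv p) x / (1 - x\<^sup>2) ^ Suc n"
    by (simp add: R_def u_def)
qed

lemma F_rep_unique:
  assumes "F_rep n p" "F_rep n q"
  shows "p = q"
proof (rule ccontr)
  assume "p \<noteq> q"
  then have fin: "finite {x. poly (p - q) x = 0}"
    by (intro poly_roots_finite) simp
  have "{-1<..<1} \<subseteq> {x. poly (p - q) x = 0}"
  proof
    fix x :: real assume x: "x \<in> {-1<..<1}"
    have "x\<^sup>2 < 1" using x by (simp add: abs_square_less_1 abs_less_iff)
    then have "1 - x\<^sup>2 \<noteq> 0" by simp
    then have "(1 - x\<^sup>2) ^ n \<noteq> 0" by (rule power_not_zero)
    moreover have "r_fun x \<noteq> 0" using x by (simp add: r_fun_def)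
    moreover have "r_fun x * poly p x / (1 - x\<^sup>2) ^ n = r_fun x * poly q x / (1 - x\<^sup>2) ^ n"
      using assms x by (simp add: F_rep_def)
    ultimately have "poly p x = poly q x" by (metis divide_cancel_right mult_cancel_left)
    then show "x \<in> {x. poly (p - q) x = 0}" by simp
  qed
  with fin have "finite {-1<..<1::real}" by (rule rev_finite_subset)
  then show False using infinite_Ioo[of "-1" "1::real"] by simp
qed

lemma F_rep_ex1: "\<exists>!p. F_rep n p"
proof -
  have "\<exists>p. F_rep n p"
    by (induction n) (use F_rep_0 F_rep_Suc in blast)+
  then show ?thesis using F_rep_unique by blast
qed

lemma F_rep_F_poly: "F_rep n (F_poly n)"
  unfolding F_poly_def by (rule theI'[OF F_rep_ex1])

lemma F_poly_eqI: "F_rep n p \<Longrightarrow> F_poly n = p"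
  using F_rep_unique F_rep_F_poly by blast

lemma F_poly_0: "F_poly 0 = 1"
  by (rule F_poly_eqI[OF F_rep_0])

lemma F_poly_Suc:
  "F_poly (Suc n) = [:0, 1, 2 * of_nat n:] * F_poly n + [:0, 1, 0, -1:] * pderiv (F_poly n)"
  by (rule F_poly_eqI[OF F_rep_Suc[OF F_rep_F_poly]])

text \<open>The odd case \<open>n = 2 * k - 1\<close> has exponent \<open>2 * k - 2 = n - 1\<close>.\<close>

definition f_poly :: "nat \<Rightarrow> real poly" where
  "f_poly n = (if odd n then (1 + [:0, 1:]\<^sup>2) * ([:0, 1:]\<^sup>2 - 1) ^ (n - 1)
          else - (([:0, 1:]\<^sup>2 - 1) ^ n))"

definition m_entry :: "nat \<Rightarrow> nat \<Rightarrow> real poly" where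
  "m_entry i j =
    (if j = 0 then (if i = 0 then [:0, 1:] else [:0, 1:] * F_poly i)
     else if j \<le> i then of_nat (i choose (j - 1)) * f_poly (i - j + 1)
     else if j = i + 1 then -1
     else 0)"

end

theory Submission
  imports Defs
begin

text \<open>
  Write \<open>T = x d/dx\<close>. The definition of \<open>r\<close> gives \<open>T r = r x / (1 - x\<^sup>2)\<close>, that is,
  \<open>(1/x - x) T r = r\<close>. Applying \<open>T\<^sup>n\<close> with the Leibniz rule and
  \<open>T\<^sup>m (1/x - x) = (-1)\<^sup>m/x - x\<close>, and then multiplying by \<open>x\<close>, yields
  \[ \sum_{k \le n} {n \choose k} \bigl((-1)^{n-k} - x^2\bigr) T^{k+1} r = x T^n r , \]
  and multiplication by \<open>(1 - x\<^sup>2)\<^sup>n / r\<close> turns this into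
  \[ x F_n + \sum_{k \le n} {n \choose k} f_{n-k} F_{k+1} = 0 . \]
  Since \<open>f\<^sub>0 = -1\<close>, the term \<open>k = n\<close> is \<open>- F\<^sub>n\<^sub>+\<^sub>1\<close>, so the identity expresses \<open>F\<^sub>n\<^sub>+\<^sub>1\<close> through its
  predecessors, and the coefficients are the entries of row \<open>n\<close> of the matrix. A lower
  Hessenberg determinant with superdiagonal \<open>-1\<close> satisfies the recurrence that its rows
  spell out (\<open>det_hessenberg_recurrence\<close>), which gives the theorem.

  The Leibniz computation is carried out inside the polynomial ring, to avoid the division
  by \<open>x\<close>: the derivation \<open>\<theta> = x (1 - x\<^sup>2) d/dx\<close> takes the place of \<open>T\<close>, and applying it to the
  identity for \<open>n\<close> produces the identity for \<open>n + 1\<close> plus a multiple of the identity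
  for \<open>n\<close> (\<open>F_poly_convolution\<close>).
\<close>

section \<open>Hessenberg determinants as linear recurrences\<close>

text \<open>
  The recurrence makes the vector \<open>(d 0, \<dots>, d n)\<close> a solution of all rows but the last. As
  \<open>d 0 = 1\<close>, replacing column \<open>0\<close> by the combination of the columns with weights \<open>d\<close> keeps the
  determinant, and leaves \<open>d (Suc n)\<close> in the last row as the only nonzero entry of that column.
  The minor of this entry is lower triangular with diagonal \<open>-1\<close>.
\<close>
lemma det_hessenberg_recurrence:
  fixes m :: "nat \<Rightarrow> nat \<Rightarrow> 'a :: idom" and d :: "nat \<Rightarrow> 'a"
  assumes super: "\<And>i. m i (Suc i) = -1"
    and above: "\<And>i j. Suc i < j \<Longrightarrow> m i j = 0"
    and d0: "d 0 = 1"
    and rec: "\<And>i. i \<le> n \<Longrightarrow> d (Suc i) = (\<Sum>j\<le>i. m i j * d j)"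
  shows "det (mat (Suc n) (Suc n) (\<lambda>(i, j). m i j)) = d (Suc n)"
proof -
  define M where "M = mat (Suc n) (Suc n) (\<lambda>(i, j). m i j)"
  define C where "C = mat (Suc n) (Suc n)
    (\<lambda>(i, j). if j = 0 then d i else if i = j then 1 else (0::'a))"
  have M: "M \<in> carrier_mat (Suc n) (Suc n)" and C: "C \<in> carrier_mat (Suc n) (Suc n)"
    by (simp_all add: M_def C_def)
  have "det C = prod_list (diag_mat C)"
    by (rule det_lower_triangular[OF _ C]) (auto simp: C_def)
  also have "\<dots> = (\<Prod>i = 0..<Suc n. C $$ (i, i))"
    using C by (simp add: prod_list_diag_prod)
  also have "\<dots> = 1"
    by (rule prod.neutral) (auto simp: C_def d0)
  finally have detC: "det C = 1" .
  have MC: "(M * C) $$ (i, j) = (\<Sum>k\<le>n. m i k * C $$ (k, j))"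
    if "i \<le> n" "j \<le> n" for i j
    using that M C
    by (auto simp: times_mat_def scalar_prod_def M_def atLeast0LessThan lessThan_Suc_atMost
        intro!: sum.cong)
  have col0: "(M * C) $$ (i, 0) = (if i = n then d (Suc n) else 0)" if i: "i \<le> n" for i
  proof -
    have eq: "(M * C) $$ (i, 0) = (\<Sum>k\<le>n. m i k * d k)"
      unfolding MC[OF i le0] by (rule sum.cong) (auto simp: C_def)
    show ?thesis
    proof (cases "i = n")
      case True
      then show ?thesis using eq rec[of n] by simp
    next
      case False
      have "(\<Sum>k\<le>n. m i k * d k) = (\<Sum>k\<le>Suc i. m i k * d k)"
        using i False by (intro sum.mono_neutral_right) (auto simp: above)
      also have "\<dots> = d (Suc i) - d (Suc i)"
        using i by (simp add: super rec)
      finally show ?thesis using False by (simp add: eq)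
    qed
  qed
  have colS: "(M * C) $$ (i, Suc j) = m i (Suc j)" if "i \<le> n" "Suc j \<le> n" for i j
  proof -
    have "(M * C) $$ (i, Suc j) = (\<Sum>k\<le>n. if k = Suc j then m i k else 0)"
      unfolding MC[OF that] using that by (intro sum.cong) (auto simp: C_def)
    then show ?thesis using that by simp
  qed
  define L where "L = mat_delete (M * C) n 0"
  have L: "L \<in> carrier_mat n n"
    using mat_delete_carrier[of "M * C" "Suc n" "Suc n" n 0] M C by (simp add: L_def)
  have Lij: "L $$ (i, j) = m i (Suc j)" if "i < n" "j < n" for i j
    using that M C by (simp add: L_def mat_delete_def colS del: index_mult_mat(1))
  have "det L = prod_list (diag_mat L)"
    by (rule det_lower_triangular[OF _ L]) (auto simp: Lij above)
  also have "\<dots> = (-1) ^ n"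
    using L by (simp add: prod_list_diag_prod Lij super)
  finally have detL: "det L = (-1) ^ n" .
  have "det M = det (M * C)"
    by (simp add: det_mult[OF M C] detC)
  also have "\<dots> = (\<Sum>i<Suc n. (M * C) $$ (i, 0) * cofactor (M * C) i 0)"
    by (rule laplace_expansion_column) (use M C in auto)
  also have "\<dots> = (\<Sum>i<Suc n. if i = n then d (Suc n) * cofactor (M * C) n 0 else 0)"
    by (rule sum.cong) (auto simp: col0)
  also have "\<dots> = d (Suc n) * cofactor (M * C) n 0"
    by simp
  also have "\<dots> = d (Suc n) * ((-1) ^ n * (-1) ^ n)"
    using detL by (simp add: cofactor_def L_def)
  also have "\<dots> = d (Suc n)"
    by (simp add: power_mult_distrib[symmetric])
  finally show ?thesis by (simp add: M_def)
qed

section \<open>The derivation \<open>x (1 - x\<^sup>2) d/dx\<close>\<close>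

definition X :: "real poly" where
  "X = [:0, 1:]"

lemma pderiv_X: "pderiv X = 1"
  by (simp add: X_def pderiv_pCons)

definition theta :: "real poly \<Rightarrow> real poly" where
  "theta p = X * (1 - X\<^sup>2) * pderiv p"

lemma theta_add: "theta (p + q) = theta p + theta q"
  by (simp add: theta_def pderiv_add distrib_left)

lemma theta_mult: "theta (p * q) = theta p * q + p * theta q"
  by (simp add: theta_def pderiv_mult algebra_simps)

lemma theta_sum: "theta (\<Sum>i\<in>A. g i) = (\<Sum>i\<in>A. theta (g i))"
  by (induction A rule: infinite_finite_induct) (simp_all add: theta_def pderiv_add distrib_left)

lemma theta_0: "theta 0 = 0"
  by (simp add: theta_def)

lemma theta_of_nat_mult: "theta (of_nat k * p) = of_nat k * theta p"
  by (simp add: theta_mult) (simp add: theta_def of_nat_poly)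

lemma theta_uminus: "theta (- p) = - theta p"
  by (simp add: theta_def pderiv_minus)

lemma theta_X: "theta X = X * (1 - X\<^sup>2)"
  by (simp add: theta_def pderiv_X)

lemma theta_1_plus_X2: "theta (1 + X\<^sup>2) = 2 * X\<^sup>2 * (1 - X\<^sup>2)"
proof -
  have "pderiv (1 + X\<^sup>2) = 2 * X"
    by (simp add: power2_eq_square pderiv_add pderiv_mult pderiv_X)
  then show ?thesis by (simp add: theta_def algebra_simps power2_eq_square)
qed

lemma theta_power_X2_minus_1:
  "theta ((X\<^sup>2 - 1) ^ m) = - 2 * of_nat m * X\<^sup>2 * (X\<^sup>2 - 1) ^ m"
proof (induction m)
  case 0
  show ?case by (simp add: theta_def)
next
  case (Suc m)
  have "theta (X\<^sup>2 - 1) = - 2 * X\<^sup>2 * (X\<^sup>2 - 1)"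
    using theta_1_plus_X2 by (simp add: theta_def pderiv_add pderiv_diff algebra_simps)
  then show ?case
    unfolding power_Suc theta_mult Suc.IH of_nat_Suc \<open>theta (X\<^sup>2 - 1) = _\<close>
    by (simp add: algebra_simps)
qed

lemma theta_F_poly:
  "theta (F_poly n) = F_poly (Suc n) - (X + 2 * of_nat n * X\<^sup>2) * F_poly n"
proof -
  have "[:0, 1, 2 * of_nat n:] = X + 2 * of_nat n * X\<^sup>2"
    by (simp add: X_def power2_eq_square of_nat_poly numeral_poly)
  moreover have "[:0, 1, 0, -1:] = X * (1 - X\<^sup>2)"
    by (simp add: X_def power2_eq_square one_pCons)
  ultimately show ?thesis
    by (simp add: F_poly_Suc theta_def)
qed

text \<open>
  Up to the normalising power of \<open>1 - x\<^sup>2\<close>, \<open>f\<^sub>m\<close> is \<open>-x T\<^sup>m (1/x - x)\<close> with \<open>T = x d/dx\<close>; one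
  more \<open>T\<close> leads from \<open>f\<^sub>m\<close> to \<open>f\<^sub>m\<^sub>+\<^sub>1\<close>, and the last summand corrects for the derivative of
  the factor \<open>x\<close> and of the normalising power.
\<close>
lemma theta_f_poly:
  "theta (f_poly m) = f_poly (Suc m) + (1 + X\<^sup>2 - 2 * of_nat m * X\<^sup>2) * f_poly m"
proof (cases "odd m")
  case True
  then obtain k where m: "m = Suc k" by (cases m) auto
  define w where "w = (X\<^sup>2 - 1) ^ k"
  have "theta (f_poly m) = theta ((1 + X\<^sup>2) * w)"
    using True by (simp add: f_poly_def X_def[symmetric] m w_def)
  also have "\<dots> = 2 * X\<^sup>2 * (1 - X\<^sup>2) * w - (1 + X\<^sup>2) * (2 * of_nat k * X\<^sup>2 * w)"
    by (simp add: theta_mult theta_1_plus_X2 theta_power_X2_minus_1 w_def)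
  also have "\<dots> = - ((X\<^sup>2 - 1) * ((X\<^sup>2 - 1) * w))
      + (1 + X\<^sup>2 - 2 * (1 + of_nat k) * X\<^sup>2) * ((1 + X\<^sup>2) * w)"
    by (simp add: algebra_simps power2_eq_square)
  also have "\<dots> = f_poly (Suc m) + (1 + X\<^sup>2 - 2 * of_nat m * X\<^sup>2) * f_poly m"
    using True by (simp add: f_poly_def X_def[symmetric] m w_def)
  finally show ?thesis .
next
  case False
  define w where "w = (X\<^sup>2 - 1) ^ m"
  have "theta (f_poly m) = 2 * of_nat m * X\<^sup>2 * w"
    using False by (simp add: f_poly_def X_def[symmetric] theta_uminus theta_power_X2_minus_1 w_def)
  also have "\<dots> = (1 + X\<^sup>2) * w - (1 + X\<^sup>2 - 2 * of_nat m * X\<^sup>2) * w"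
    by (simp add: algebra_simps power2_eq_square)
  also have "\<dots> = f_poly (Suc m) + (1 + X\<^sup>2 - 2 * of_nat m * X\<^sup>2) * f_poly m"
    using False by (simp add: f_poly_def X_def[symmetric] w_def)
  finally show ?thesis .
qed

section \<open>The convolution identity\<close>

text \<open>Pascal's rule, in the form in which it enters the Leibniz formula.\<close>
lemma sum_binomial_Suc:
  fixes g :: "nat \<Rightarrow> nat \<Rightarrow> 'a :: comm_semiring_1"
  shows "(\<Sum>k\<le>Suc n. of_nat (Suc n choose k) * g (Suc n - k) k) =
    (\<Sum>k\<le>n. of_nat (n choose k) * (g (Suc (n - k)) k + g (n - k) (Suc k)))"
proof -
  have "(\<Sum>k\<le>Suc n. of_nat (Suc n choose k) * g (Suc n - k) k) =
      g (Suc n) 0 + (\<Sum>k\<le>n. of_nat (n choose Suc k) * g (n - k) (Suc k))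
      + (\<Sum>k\<le>n. of_nat (n choose k) * g (n - k) (Suc k))"
    by (subst sum.atMost_Suc_shift) (simp add: sum.distrib algebra_simps)
  also have "g (Suc n) 0 + (\<Sum>k\<le>n. of_nat (n choose Suc k) * g (n - k) (Suc k)) =
      (\<Sum>k\<le>Suc n. of_nat (n choose k) * g (Suc n - k) k)"
    by (subst sum.atMost_Suc_shift) simp
  also have "\<dots> = (\<Sum>k\<le>n. of_nat (n choose k) * g (Suc (n - k)) k)"
    by (simp add: Suc_diff_le binomial_eq_0)
  finally show ?thesis
    by (simp add: sum.distrib distrib_left)
qed

text \<open>
  Let \<open>E n\<close> be the left-hand side, and apply \<open>\<theta>\<close>. In each product \<open>f\<^sub>n\<^sub>-\<^sub>k F\<^sub>k\<^sub>+\<^sub>1\<close> the correction terms of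
  the two factors depend on \<open>n - k\<close> and on \<open>k\<close>, but their sum depends on \<open>n\<close> alone and equals
  the correction term of \<open>x F\<^sub>n\<close>. Hence \<open>\<theta> (E n) = E (n + 1) + c E n\<close> for a polynomial \<open>c\<close>,
  and \<open>E n = 0\<close> implies \<open>E (n + 1) = 0\<close>.
\<close>
lemma F_poly_convolution:
  "X * F_poly n + (\<Sum>k\<le>n. of_nat (n choose k) * (f_poly (n - k) * F_poly (Suc k))) = 0"
proof (induction n)
  case 0
  show ?case by (simp add: f_poly_def F_poly_0 F_poly_Suc X_def)
next
  case (Suc n)
  define c where "c = 1 - X - (2 * of_nat n + 1) * X\<^sup>2"
  define S where "S = (\<lambda>n. \<Sum>k\<le>n. of_nat (n choose k) * (f_poly (n - k) * F_poly (Suc k)))"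
  have prod: "theta (f_poly (n - k) * F_poly (Suc k)) =
      (f_poly (Suc (n - k)) * F_poly (Suc k) + f_poly (n - k) * F_poly (Suc (Suc k)))
      + c * (f_poly (n - k) * F_poly (Suc k))" if "k \<le> n" for k
  proof -
    have n: "of_nat n = (of_nat (n - k) + of_nat k :: real poly)"
      using that by (simp flip: of_nat_add)
    show ?thesis
      unfolding theta_mult theta_f_poly theta_F_poly c_def n of_nat_Suc
      by (simp add: algebra_simps)
  qed
  have "theta (S n) = (\<Sum>k\<le>n. of_nat (n choose k) * theta (f_poly (n - k) * F_poly (Suc k)))"
    by (simp only: S_def theta_sum theta_of_nat_mult)
  also have "\<dots> = (\<Sum>k\<le>n. of_nat (n choose k) *
        (f_poly (Suc (n - k)) * F_poly (Suc k) + f_poly (n - k) * F_poly (Suc (Suc k)))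
      + c * (of_nat (n choose k) * (f_poly (n - k) * F_poly (Suc k))))"
    by (rule sum.cong) (simp_all only: prod atMost_iff distrib_left mult.left_commute)
  also have "\<dots> = (\<Sum>k\<le>n. of_nat (n choose k) *
      (f_poly (Suc (n - k)) * F_poly (Suc k) + f_poly (n - k) * F_poly (Suc (Suc k)))) + c * S n"
    by (simp only: S_def sum.distrib sum_distrib_left)
  also have "\<dots> = S (Suc n) + c * S n"
    unfolding S_def
    by (subst sum_binomial_Suc[where g = "\<lambda>m k. f_poly m * F_poly (Suc k)"]) (rule refl)
  finally have theta_S: "theta (S n) = S (Suc n) + c * S n" .
  have theta_XF: "theta (X * F_poly n) = X * F_poly (Suc n) + c * (X * F_poly n)"
    unfolding theta_mult theta_X theta_F_poly c_def by (simp add: algebra_simps power2_eq_square)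
  have IH: "X * F_poly n + S n = 0"
    using Suc.IH by (simp add: S_def)
  then have "0 = theta (X * F_poly n + S n)"
    by (simp only: theta_0)
  also have "\<dots> = X * F_poly (Suc n) + S (Suc n) + c * (X * F_poly n + S n)"
    unfolding theta_add theta_S theta_XF by (simp add: algebra_simps power2_eq_square)
  finally have "X * F_poly (Suc n) + S (Suc n) = 0"
    unfolding IH by simp
  then show ?case by (simp only: S_def)
qed

section \<open>The determinant\<close>

text \<open>
  With \<open>f\<^sub>0 = -1\<close>, the top term of the convolution identity is moved to the other side; column
  \<open>j = k + 1\<close> carries the term with index \<open>k\<close>, and column \<open>0\<close> the term \<open>x F\<^sub>i\<close>.
\<close>
lemma F_poly_row_recurrence:
  "F_poly (Suc i) = (\<Sum>j\<le>i. m_entry i j * F_poly j)"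
proof -
  have "(\<Sum>j\<le>i. m_entry i j * F_poly j) =
      X * F_poly i + (\<Sum>k<i. m_entry i (Suc k) * F_poly (Suc k))"
    by (simp add: sum.atMost_shift m_entry_def F_poly_0 F_poly_Suc X_def)
  also have "(\<Sum>k<i. m_entry i (Suc k) * F_poly (Suc k)) =
      (\<Sum>k<i. of_nat (i choose k) * (f_poly (i - k) * F_poly (Suc k)))"
    by (rule sum.cong) (auto simp: m_entry_def Suc_diff_Suc mult.assoc)
  also have "X * F_poly i + \<dots> = F_poly (Suc i)"
    using F_poly_convolution[of i]
    by (simp add: lessThan_Suc_atMost[symmetric] f_poly_def algebra_simps)
  finally show ?thesis ..
qed

theorem theorem23:
  fixes n :: nat
  shows "F_poly (n + 1) = det (mat (n + 1) (n + 1) (\<lambda>(i, j). m_entry i j))"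
  using det_hessenberg_recurrence[of m_entry F_poly n]
  by (simp add: m_entry_def[of _ "Suc _"] F_poly_0 F_poly_row_recurrence m_entry_def)

end
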